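(* Let $R$ be a unital commutative ring, $\mathcal A$ an $R$-algebra and $\phi$ an $R$-algebra endomorphism of $\mathcal A$. Then the following statements hold: (1) if $\phi^2=\phi$, then $\operatorname{Im}(\mathrm I-\phi)=\operatorname{Ker}\phi$; (2) if $\phi^2=\mathrm I$ and $2\cdot 1_R$ is a unit of $R$, then $\operatorname{Im}(\mathrm I-\phi)=\operatorname{Ker}(\mathrm I+\phi)$ and $\mathfrak r(\operatorname{Im}(\mathrm I-\phi))=\operatorname{nil}(\mathcal A)$. In both cases, $\operatorname{Im}(\mathrm I-\phi)$ is a Mathieu subspace of $\mathcal A$.
   Context: Algebras are associative and not necessarily commutative. $\mathrm I$ denotes the identity map of $\mathcal A$. $\operatorname{nil}(\mathcal A)$ denotes the set of all nilpotent elements of $\mathcal A$ (also when $\mathcal A$ is not commutative). For an $R$-submodule $V$ of $\mathcal A$, the radical $\mathfrak r(V)$ is the set of $a\in\mathcal A$ such that $a^m\in V$ for all sufficiently large $m$. $V$ is a (two-sided) Mathieu subspace of $\mathcal A$ if for all $a,b,c\in\mathcal A$ with $a^m\in V$ for all $m\ge1$, one has $ba^mc\in V$ for all sufficiently large $m$. *)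

theory Defs
  imports "HOL-Algebra.Algebra"
begin

(* An associative algebra over a commutative unital ring, in general neither commutative nor
   unital: the field one of the record A is never used.  The library locale "algebra" would
   force A to be a commutative unital ring. *)
locale assoc_algebra = module R A
  for R :: "('r, 'm) ring_scheme" and A :: "('r, 'a, 'n) module_scheme" +
  assumes mult_closed: "x \<in> carrier A \<Longrightarrow> y \<in> carrier A \<Longrightarrow> x \<otimes>\<^bsub>A\<^esub> y \<in> carrier A"
    and mult_assoc: "x \<in> carrier A \<Longrightarrow> y \<in> carrier A \<Longrightarrow> z \<in> carrier A \<Longrightarrow>
          (x \<otimes>\<^bsub>A\<^esub> y) \<otimes>\<^bsub>A\<^esub> z = x \<otimes>\<^bsub>A\<^esub> (y \<otimes>\<^bsub>A\<^esub> z)"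
    and mult_l_distr: "x \<in> carrier A \<Longrightarrow> y \<in> carrier A \<Longrightarrow> z \<in> carrier A \<Longrightarrow>
          (x \<oplus>\<^bsub>A\<^esub> y) \<otimes>\<^bsub>A\<^esub> z = x \<otimes>\<^bsub>A\<^esub> z \<oplus>\<^bsub>A\<^esub> y \<otimes>\<^bsub>A\<^esub> z"
    and mult_r_distr: "x \<in> carrier A \<Longrightarrow> y \<in> carrier A \<Longrightarrow> z \<in> carrier A \<Longrightarrow>
          z \<otimes>\<^bsub>A\<^esub> (x \<oplus>\<^bsub>A\<^esub> y) = z \<otimes>\<^bsub>A\<^esub> x \<oplus>\<^bsub>A\<^esub> z \<otimes>\<^bsub>A\<^esub> y"
    and smult_mult_left: "r \<in> carrier R \<Longrightarrow> x \<in> carrier A \<Longrightarrow> y \<in> carrier A \<Longrightarrow>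
          (r \<odot>\<^bsub>A\<^esub> x) \<otimes>\<^bsub>A\<^esub> y = r \<odot>\<^bsub>A\<^esub> (x \<otimes>\<^bsub>A\<^esub> y)"
    and smult_mult_right: "r \<in> carrier R \<Longrightarrow> x \<in> carrier A \<Longrightarrow> y \<in> carrier A \<Longrightarrow>
          x \<otimes>\<^bsub>A\<^esub> (r \<odot>\<^bsub>A\<^esub> y) = r \<odot>\<^bsub>A\<^esub> (x \<otimes>\<^bsub>A\<^esub> y)"

(* The library's ring_hom additionally requires the identity to be preserved, which makes no
   sense without a unit. *)
definition algebra_endo :: "('r, 'm) ring_scheme \<Rightarrow> ('r, 'a, 'n) module_scheme \<Rightarrow> ('a \<Rightarrow> 'a) set"
  where "algebra_endo R A =
    {f. f \<in> hom A A \<and> f \<in> hom (add_monoid A) (add_monoid A) \<and>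
        (\<forall>r\<in>carrier R. \<forall>x\<in>carrier A. f (r \<odot>\<^bsub>A\<^esub> x) = r \<odot>\<^bsub>A\<^esub> f x)}"

(* The power a^m for m >= 1, formed without an identity element (the library power [^] starts
   from the identity).  The value a at m = 0 is a dummy that is never used. *)
definition pos_pow :: "('a, 'n) monoid_scheme \<Rightarrow> 'a \<Rightarrow> nat \<Rightarrow> 'a"
  where "pos_pow A a m = ((\<lambda>x. x \<otimes>\<^bsub>A\<^esub> a) ^^ (m - 1)) a"

lemma pos_pow_1: "pos_pow A a 1 = a"
  by (simp add: pos_pow_def)

lemma pos_pow_Suc: "m \<ge> 1 \<Longrightarrow> pos_pow A a (Suc m) = pos_pow A a m \<otimes>\<^bsub>A\<^esub> a"
  by (cases m) (simp_all add: pos_pow_def)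

lemma (in monoid) pos_pow_eq_nat_pow:
  assumes "a \<in> carrier G" "m \<ge> 1"
  shows "pos_pow G a m = a [^] m"
  using assms(2)
proof (induction m rule: nat_induct_at_least)
  case base
  show ?case using assms(1) by (simp add: pos_pow_def)
next
  case (Suc m)
  then show ?case by (simp add: pos_pow_Suc)
qed

definition nilpotents :: "('a, 'n) ring_scheme \<Rightarrow> 'a set"
  where "nilpotents A = {a \<in> carrier A. \<exists>m\<ge>1. pos_pow A a m = \<zero>\<^bsub>A\<^esub>}"

definition radical :: "('a, 'n) ring_scheme \<Rightarrow> 'a set \<Rightarrow> 'a set"
  where "radical A V = {a \<in> carrier A. \<exists>N\<ge>1. \<forall>m\<ge>N. pos_pow A a m \<in> V}"

definition mathieu_subspace ::
    "('r, 'm) ring_scheme \<Rightarrow> ('r, 'a, 'n) module_scheme \<Rightarrow> 'a set \<Rightarrow> bool"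
  where "mathieu_subspace R A V \<longleftrightarrow> submodule V R A \<and>
    (\<forall>a\<in>carrier A. \<forall>b\<in>carrier A. \<forall>c\<in>carrier A.
       (\<forall>m\<ge>1. pos_pow A a m \<in> V) \<longrightarrow>
       (\<exists>N\<ge>1. \<forall>m\<ge>N. b \<otimes>\<^bsub>A\<^esub> pos_pow A a m \<otimes>\<^bsub>A\<^esub> c \<in> V))"

end

theory Submission
  imports Defs
begin

text \<open>For an involution the key computation is: if \<open>\<phi> a\<^sup>m = - a\<^sup>m\<close>, then squaring gives
  \<open>\<phi> a\<^sup>2\<^sup>m = a\<^sup>2\<^sup>m\<close>. If also \<open>\<phi> a\<^sup>2\<^sup>m = - a\<^sup>2\<^sup>m\<close>, then \<open>2 a\<^sup>2\<^sup>m = 0\<close>, hence \<open>a\<close> is nilpotent.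
  The Mathieu condition then holds because \<open>b a\<^sup>m c\<close> vanishes for large \<open>m\<close>. For an
  idempotent, the image of \<open>I - \<phi>\<close> is the kernel of \<open>\<phi>\<close>, a two-sided ideal.\<close>

context assoc_algebra
begin

lemma mult_zero_left:
  assumes "x \<in> carrier A" shows "\<zero>\<^bsub>A\<^esub> \<otimes>\<^bsub>A\<^esub> x = \<zero>\<^bsub>A\<^esub>"
proof -
  have "\<zero>\<^bsub>A\<^esub> \<otimes>\<^bsub>A\<^esub> x \<oplus>\<^bsub>A\<^esub> \<zero>\<^bsub>A\<^esub> \<otimes>\<^bsub>A\<^esub> x = \<zero>\<^bsub>A\<^esub> \<otimes>\<^bsub>A\<^esub> x"
    using mult_l_distr[of "\<zero>\<^bsub>A\<^esub>" "\<zero>\<^bsub>A\<^esub>" x] assms by simp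
  then show ?thesis
    using assms by (simp add: mult_closed)
qed

lemma mult_zero_right:
  assumes "x \<in> carrier A" shows "x \<otimes>\<^bsub>A\<^esub> \<zero>\<^bsub>A\<^esub> = \<zero>\<^bsub>A\<^esub>"
proof -
  have "x \<otimes>\<^bsub>A\<^esub> \<zero>\<^bsub>A\<^esub> \<oplus>\<^bsub>A\<^esub> x \<otimes>\<^bsub>A\<^esub> \<zero>\<^bsub>A\<^esub> = x \<otimes>\<^bsub>A\<^esub> \<zero>\<^bsub>A\<^esub>"
    using mult_r_distr[of "\<zero>\<^bsub>A\<^esub>" "\<zero>\<^bsub>A\<^esub>" x] assms by simp
  then show ?thesis
    using assms by (simp add: mult_closed)
qed

text \<open>Both products are additive inverses of the mixed product \<open>?m\<close>, so
  cancellation identifies them.\<close>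

lemma mult_a_inv_a_inv:
  assumes x: "x \<in> carrier A" and y: "y \<in> carrier A"
  shows "(\<ominus>\<^bsub>A\<^esub> x) \<otimes>\<^bsub>A\<^esub> (\<ominus>\<^bsub>A\<^esub> y) = x \<otimes>\<^bsub>A\<^esub> y"
proof -
  let ?m = "x \<otimes>\<^bsub>A\<^esub> (\<ominus>\<^bsub>A\<^esub> y)"
  have 1: "(\<ominus>\<^bsub>A\<^esub> x) \<otimes>\<^bsub>A\<^esub> (\<ominus>\<^bsub>A\<^esub> y) \<oplus>\<^bsub>A\<^esub> ?m = \<zero>\<^bsub>A\<^esub>"
    using mult_l_distr[of "\<ominus>\<^bsub>A\<^esub> x" x "\<ominus>\<^bsub>A\<^esub> y"] assms by (simp add: M.l_neg mult_zero_left)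
  have 2: "x \<otimes>\<^bsub>A\<^esub> y \<oplus>\<^bsub>A\<^esub> ?m = \<zero>\<^bsub>A\<^esub>"
    using mult_r_distr[of y "\<ominus>\<^bsub>A\<^esub> y" x] assms by (simp add: M.r_neg mult_zero_right)
  show ?thesis
    using 1 2 assms by (metis M.add.right_cancel M.a_inv_closed mult_closed)
qed

lemma pos_pow_closed:
  assumes a: "a \<in> carrier A" and m: "m \<ge> 1"
  shows "pos_pow A a m \<in> carrier A"
  using m by (induction m rule: nat_induct_at_least)
    (use a in \<open>simp_all add: pos_pow_1[simplified] pos_pow_Suc mult_closed\<close>)

text \<open>Both lower bounds matter: exponent 0 carries the dummy value \<open>a\<close>, for which
  the law fails in general.\<close>

lemma pos_pow_add:
  assumes a: "a \<in> carrier A" and m: "m \<ge> 1" and n: "n \<ge> 1"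
  shows "pos_pow A a (m + n) = pos_pow A a m \<otimes>\<^bsub>A\<^esub> pos_pow A a n"
  using n
proof (induction n rule: nat_induct_at_least)
  case base
  then show ?case using m by (simp add: pos_pow_Suc pos_pow_1[simplified])
next
  case (Suc n)
  then show ?case using m a by (simp add: pos_pow_Suc mult_assoc pos_pow_closed)
qed

text \<open>Upgrades one vanishing power to the "for all large m" form occurring in the radical and
  in the Mathieu condition.\<close>

lemma pos_pow_zero_mono:
  assumes a: "a \<in> carrier A" and "N \<ge> 1" "pos_pow A a N = \<zero>\<^bsub>A\<^esub>" and "m \<ge> N"
  shows "pos_pow A a m = \<zero>\<^bsub>A\<^esub>"
  using \<open>m \<ge> N\<close>
proof (induction m rule: nat_induct_at_least)
  case base
  then show ?case using assms by simp
next
  case (Suc n)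
  then show ?case using assms by (simp add: pos_pow_Suc mult_zero_left)
qed

lemma nilpotents_subset_radical:
  assumes "\<zero>\<^bsub>A\<^esub> \<in> V"
  shows "nilpotents A \<subseteq> radical A V"
  unfolding nilpotents_def radical_def using assms pos_pow_zero_mono by fastforce

text \<open>Only additivity and R-linearity are asked of \<open>f\<close>, so that the result covers
  I + \<phi>, which in general is not multiplicative, as well as \<phi>.\<close>

lemma submodule_a_kernel:
  assumes f: "f \<in> hom (add_monoid A) (add_monoid A)"
    and smult: "\<And>r x. r \<in> carrier R \<Longrightarrow> x \<in> carrier A \<Longrightarrow> f (r \<odot>\<^bsub>A\<^esub> x) = r \<odot>\<^bsub>A\<^esub> f x"
  shows "submodule (a_kernel A A f) R A"
proof -
  interpret group_hom "add_monoid A" "add_monoid A" f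
    using f by (simp add: group_hom_def group_hom_axioms_def M.a_group)
  show ?thesis
    using subgroup_kernel smult
    by (auto simp: submodule_def submodule_axioms_def a_kernel_def kernel_def)
qed

text \<open>The threshold \<open>N = 1\<close> works here: every power of \<open>a\<close> lies in
  \<open>V\<close>, and \<open>V\<close> absorbs factors on both sides.\<close>

lemma mathieu_subspace_if_absorbing:
  assumes "submodule V R A"
    and "\<And>b v c. b \<in> carrier A \<Longrightarrow> v \<in> V \<Longrightarrow> c \<in> carrier A \<Longrightarrow> b \<otimes>\<^bsub>A\<^esub> v \<otimes>\<^bsub>A\<^esub> c \<in> V"
  shows "mathieu_subspace R A V"
  unfolding mathieu_subspace_def using assms by blast

lemma mathieu_subspace_if_radical_nilpotent:
  assumes V: "submodule V R A" and rad: "radical A V \<subseteq> nilpotents A"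
  shows "mathieu_subspace R A V"
  unfolding mathieu_subspace_def
proof (intro conjI ballI impI)
  fix a b c
  assume a: "a \<in> carrier A" and b: "b \<in> carrier A" and c: "c \<in> carrier A"
    and pow: "\<forall>m\<ge>1. pos_pow A a m \<in> V"
  \<comment> \<open>All powers of \<open>a\<close> lie in \<open>V\<close>, so \<open>a\<close> is
    in the radical with threshold 1.\<close>
  have "a \<in> nilpotents A"
    using rad a pow by (auto simp: radical_def)
  then obtain N where N: "N \<ge> 1" "pos_pow A a N = \<zero>\<^bsub>A\<^esub>"
    by (auto simp: nilpotents_def)
  have "\<zero>\<^bsub>A\<^esub> \<in> V"
    using subgroup.one_closed[OF submodule.axioms(1)[OF V]] by simp
  then have "\<forall>m\<ge>N. b \<otimes>\<^bsub>A\<^esub> pos_pow A a m \<otimes>\<^bsub>A\<^esub> c \<in> V"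
    using pos_pow_zero_mono[OF a N] b c by (simp add: mult_zero_left mult_zero_right)
  then show "\<exists>N\<ge>1. \<forall>m\<ge>N. b \<otimes>\<^bsub>A\<^esub> pos_pow A a m \<otimes>\<^bsub>A\<^esub> c \<in> V"
    using N(1) by blast
qed (rule V)

end

locale assoc_algebra_endo = assoc_algebra R A
  for R :: "('r, 'm) ring_scheme" and A :: "('r, 'a, 'n) module_scheme" +
  fixes \<phi> :: "'a \<Rightarrow> 'a"
  assumes endo: "\<phi> \<in> algebra_endo R A"
begin

lemma endo_closed: "x \<in> carrier A \<Longrightarrow> \<phi> x \<in> carrier A"
  using endo by (auto simp: algebra_endo_def hom_def)

lemma endo_mult: "x \<in> carrier A \<Longrightarrow> y \<in> carrier A \<Longrightarrow> \<phi> (x \<otimes>\<^bsub>A\<^esub> y) = \<phi> x \<otimes>\<^bsub>A\<^esub> \<phi> y"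
  using endo by (auto simp: algebra_endo_def hom_def)

lemma endo_add: "x \<in> carrier A \<Longrightarrow> y \<in> carrier A \<Longrightarrow> \<phi> (x \<oplus>\<^bsub>A\<^esub> y) = \<phi> x \<oplus>\<^bsub>A\<^esub> \<phi> y"
  using endo by (auto simp: algebra_endo_def hom_def)

lemma endo_smult: "r \<in> carrier R \<Longrightarrow> x \<in> carrier A \<Longrightarrow> \<phi> (r \<odot>\<^bsub>A\<^esub> x) = r \<odot>\<^bsub>A\<^esub> \<phi> x"
  using endo by (auto simp: algebra_endo_def)

lemma endo_zero: "\<phi> \<zero>\<^bsub>A\<^esub> = \<zero>\<^bsub>A\<^esub>"
  using endo_add[of "\<zero>\<^bsub>A\<^esub>" "\<zero>\<^bsub>A\<^esub>"] by (simp add: endo_closed)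

lemma endo_a_inv: "x \<in> carrier A \<Longrightarrow> \<phi> (\<ominus>\<^bsub>A\<^esub> x) = \<ominus>\<^bsub>A\<^esub> \<phi> x"
  using endo_add[of "\<ominus>\<^bsub>A\<^esub> x" x]
  by (simp add: endo_closed endo_zero M.l_neg M.minus_equality)

lemma submodule_kernel_endo: "submodule (a_kernel A A \<phi>) R A"
  using endo by (intro submodule_a_kernel) (auto simp: algebra_endo_def)

lemma submodule_kernel_plus: "submodule (a_kernel A A (\<lambda>a. a \<oplus>\<^bsub>A\<^esub> \<phi> a)) R A"
  by (intro submodule_a_kernel)
    (auto simp: hom_def endo_closed endo_add endo_smult M.a_ac smult_r_distr)

lemma image_minus_idempotent:
  assumes "\<forall>a\<in>carrier A. \<phi> (\<phi> a) = \<phi> a"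
  shows "(\<lambda>a. a \<ominus>\<^bsub>A\<^esub> \<phi> a) ` carrier A = a_kernel A A \<phi>"
proof (intro equalityI subsetI)
  fix x assume "x \<in> a_kernel A A \<phi>"
  \<comment> \<open>An element killed by \<phi> is its own preimage under I - \<phi>.\<close>
  then have "x \<in> carrier A" "x = x \<ominus>\<^bsub>A\<^esub> \<phi> x"
    by (auto simp: a_kernel_def kernel_def a_minus_def)
  then show "x \<in> (\<lambda>a. a \<ominus>\<^bsub>A\<^esub> \<phi> a) ` carrier A" by blast
\<comment> \<open>The other inclusion is \<phi>(a - \<phi> a) = \<phi> a - \<phi>(\<phi> a) = 0 by
  idempotence.\<close>
qed (use assms in \<open>auto simp: a_kernel_def kernel_def endo_closed a_minus_def M.r_neg
  endo_add endo_a_inv\<close>)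

text \<open>If \<phi> v = 0, then \<phi>(b v c) is a product with a zero factor, so the kernel is
  absorbing.\<close>

lemma mathieu_kernel_endo: "mathieu_subspace R A (a_kernel A A \<phi>)"
  using submodule_kernel_endo
  by (rule mathieu_subspace_if_absorbing)
    (auto simp: a_kernel_def kernel_def mult_closed endo_mult endo_closed mult_zero_left mult_zero_right)

end

text \<open>A unit 2 makes doubling on the module surjective, by scaling with its inverse;
  \<open>double_eq_zero\<close> is the injective counterpart.\<close>

lemma (in module) half:
  assumes u: "\<one>\<^bsub>R\<^esub> \<oplus>\<^bsub>R\<^esub> \<one>\<^bsub>R\<^esub> \<in> Units R" and x: "x \<in> carrier M"
  obtains y where "y \<in> carrier M" "y \<oplus>\<^bsub>M\<^esub> y = x"
proof -
  let ?h = "inv\<^bsub>R\<^esub> (\<one>\<^bsub>R\<^esub> \<oplus>\<^bsub>R\<^esub> \<one>\<^bsub>R\<^esub>)"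
  have h: "?h \<in> carrier R" "(\<one>\<^bsub>R\<^esub> \<oplus>\<^bsub>R\<^esub> \<one>\<^bsub>R\<^esub>) \<otimes>\<^bsub>R\<^esub> ?h = \<one>\<^bsub>R\<^esub>"
    using u by simp_all
  have "x = ((\<one>\<^bsub>R\<^esub> \<oplus>\<^bsub>R\<^esub> \<one>\<^bsub>R\<^esub>) \<otimes>\<^bsub>R\<^esub> ?h) \<odot>\<^bsub>M\<^esub> x"
    using h x by simp
  also have "\<dots> = ?h \<odot>\<^bsub>M\<^esub> x \<oplus>\<^bsub>M\<^esub> ?h \<odot>\<^bsub>M\<^esub> x"
    using h(1) x by (simp only: smult_assoc1 smult_l_distr R.one_closed R.a_closed smult_closed smult_one)
  finally show ?thesis
    using that[of "?h \<odot>\<^bsub>M\<^esub> x"] h(1) x by simp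
qed

lemma (in module) double_eq_zero:
  assumes u: "\<one>\<^bsub>R\<^esub> \<oplus>\<^bsub>R\<^esub> \<one>\<^bsub>R\<^esub> \<in> Units R" and x: "x \<in> carrier M"
    and xx: "x \<oplus>\<^bsub>M\<^esub> x = \<zero>\<^bsub>M\<^esub>"
  shows "x = \<zero>\<^bsub>M\<^esub>"
proof -
  let ?h = "inv\<^bsub>R\<^esub> (\<one>\<^bsub>R\<^esub> \<oplus>\<^bsub>R\<^esub> \<one>\<^bsub>R\<^esub>)"
  have h: "?h \<in> carrier R" "?h \<otimes>\<^bsub>R\<^esub> (\<one>\<^bsub>R\<^esub> \<oplus>\<^bsub>R\<^esub> \<one>\<^bsub>R\<^esub>) = \<one>\<^bsub>R\<^esub>"
    using u by simp_all
  have "x = ?h \<odot>\<^bsub>M\<^esub> (x \<oplus>\<^bsub>M\<^esub> x)"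
    using smult_assoc1[of ?h "\<one>\<^bsub>R\<^esub> \<oplus>\<^bsub>R\<^esub> \<one>\<^bsub>R\<^esub>" x] h x by (simp add: smult_l_distr)
  then show ?thesis using xx h(1) by simp
qed

context assoc_algebra_endo
begin

lemma image_minus_involution:
  assumes inv: "\<forall>a\<in>carrier A. \<phi> (\<phi> a) = a" and u: "\<one>\<^bsub>R\<^esub> \<oplus>\<^bsub>R\<^esub> \<one>\<^bsub>R\<^esub> \<in> Units R"
  shows "(\<lambda>a. a \<ominus>\<^bsub>A\<^esub> \<phi> a) ` carrier A = a_kernel A A (\<lambda>a. a \<oplus>\<^bsub>A\<^esub> \<phi> a)"
proof (intro equalityI subsetI)
  fix x assume "x \<in> (\<lambda>a. a \<ominus>\<^bsub>A\<^esub> \<phi> a) ` carrier A"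
  then obtain a where a: "a \<in> carrier A" "x = a \<ominus>\<^bsub>A\<^esub> \<phi> a" by blast
  \<comment> \<open>The involution interchanges \<open>a\<close> and \<phi> a, hence reverses the
    sign of their difference.\<close>
  have "\<phi> x = \<ominus>\<^bsub>A\<^esub> x"
    using a inv by (simp add: a_minus_def endo_add endo_a_inv endo_closed M.minus_add M.a_comm)
  then show "x \<in> a_kernel A A (\<lambda>a. a \<oplus>\<^bsub>A\<^esub> \<phi> a)"
    using a by (simp add: a_kernel_def kernel_def endo_closed M.r_neg)
next
  fix x assume "x \<in> a_kernel A A (\<lambda>a. a \<oplus>\<^bsub>A\<^esub> \<phi> a)"
  then have x: "x \<in> carrier A" "x \<oplus>\<^bsub>A\<^esub> \<phi> x = \<zero>\<^bsub>A\<^esub>"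
    by (auto simp: a_kernel_def kernel_def)
  \<comment> \<open>Since \<phi> x = -x, applying I - \<phi> to \<open>x\<close> gives 2x; the
    preimage sought is therefore half of \<open>x\<close>.\<close>
  obtain y where y: "y \<in> carrier A" "y \<oplus>\<^bsub>A\<^esub> y = x"
    using half[OF u x(1)] .
  let ?s = "y \<oplus>\<^bsub>A\<^esub> \<phi> y"
  have s: "?s \<in> carrier A" using y by (simp add: endo_closed)
  \<comment> \<open>To pass the relation \<phi> x = -x on to \<open>y\<close>, the sum
    \<open>?s\<close> is doubled: its double vanishes, hence so does \<open>?s\<close>.\<close>
  have "?s \<oplus>\<^bsub>A\<^esub> ?s = x \<oplus>\<^bsub>A\<^esub> \<phi> x"
    unfolding y(2)[symmetric] using y(1) by (simp add: endo_add endo_closed M.a_ac)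
  then have "?s = \<zero>\<^bsub>A\<^esub>"
    using double_eq_zero[OF u s] x(2) by simp
  then have "\<phi> y = \<ominus>\<^bsub>A\<^esub> y"
    using y(1) by (metis M.add.inv_comm M.minus_equality endo_closed)
  then have "x = y \<ominus>\<^bsub>A\<^esub> \<phi> y"
    using y by (simp add: a_minus_def)
  then show "x \<in> (\<lambda>a. a \<ominus>\<^bsub>A\<^esub> \<phi> a) ` carrier A"
    using y(1) by blast
qed

lemma radical_kernel_plus:
  assumes u: "\<one>\<^bsub>R\<^esub> \<oplus>\<^bsub>R\<^esub> \<one>\<^bsub>R\<^esub> \<in> Units R"
  shows "radical A (a_kernel A A (\<lambda>a. a \<oplus>\<^bsub>A\<^esub> \<phi> a)) = nilpotents A" (is "radical A ?K = _")
proof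
  show "radical A ?K \<subseteq> nilpotents A"
  proof
    fix a assume "a \<in> radical A ?K"
    then obtain N where a: "a \<in> carrier A" and N: "N \<ge> 1" "\<forall>m\<ge>N. pos_pow A a m \<in> ?K"
      by (auto simp: radical_def)
    \<comment> \<open>Both exponents reach the threshold \<open>N\<close>, so \<open>p\<close> and
      its square \<open>q\<close> are both in the kernel of I + \<phi>.\<close>
    define p q where "p = pos_pow A a N" and "q = pos_pow A a (N + N)"
    have pq: "p \<in> carrier A" "q \<in> carrier A" "q = p \<otimes>\<^bsub>A\<^esub> p"
      using a N(1) by (simp_all add: p_def q_def pos_pow_closed pos_pow_add mult_closed)
    have K: "p \<oplus>\<^bsub>A\<^esub> \<phi> p = \<zero>\<^bsub>A\<^esub>" "q \<oplus>\<^bsub>A\<^esub> \<phi> q = \<zero>\<^bsub>A\<^esub>"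
      using N(2) by (auto simp: p_def q_def a_kernel_def kernel_def)
    have "\<phi> p = \<ominus>\<^bsub>A\<^esub> p"
      using K(1) pq(1) by (metis M.add.inv_comm M.minus_equality endo_closed)
    \<comment> \<open>The two signs cancel in (-p)(-p). Together with q + \<phi> q = 0 this leaves
      2q = 0.\<close>
    then have "\<phi> q = q"
      using pq by (simp add: endo_mult mult_a_inv_a_inv)
    then have "q = \<zero>\<^bsub>A\<^esub>"
      using double_eq_zero[OF u pq(2)] K(2) by simp
    then show "a \<in> nilpotents A"
      using a N(1) unfolding nilpotents_def q_def by (intro CollectI conjI exI[of _ "N + N"]) auto
  qed
  show "nilpotents A \<subseteq> radical A ?K"
    by (rule nilpotents_subset_radical) (simp add: a_kernel_def kernel_def endo_zero)
qed

lemma mathieu_kernel_plus: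
  assumes "\<one>\<^bsub>R\<^esub> \<oplus>\<^bsub>R\<^esub> \<one>\<^bsub>R\<^esub> \<in> Units R"
  shows "mathieu_subspace R A (a_kernel A A (\<lambda>a. a \<oplus>\<^bsub>A\<^esub> \<phi> a))"
  using submodule_kernel_plus radical_kernel_plus[OF assms]
  by (simp add: mathieu_subspace_if_radical_nilpotent)

end

theorem proposition5p2:
  fixes R :: "('r, 'm) ring_scheme" and A :: "('r, 'a, 'n) module_scheme" and \<phi> :: "'a \<Rightarrow> 'a"
  assumes "assoc_algebra R A"
    and "\<phi> \<in> algebra_endo R A"
  defines "Im_I_minus \<equiv> (\<lambda>a. a \<ominus>\<^bsub>A\<^esub> \<phi> a) ` carrier A"
  shows "((\<forall>a\<in>carrier A. \<phi> (\<phi> a) = \<phi> a) \<longrightarrow>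
           Im_I_minus = a_kernel A A \<phi> \<and>
           mathieu_subspace R A Im_I_minus) \<and>
         ((\<forall>a\<in>carrier A. \<phi> (\<phi> a) = a) \<and> \<one>\<^bsub>R\<^esub> \<oplus>\<^bsub>R\<^esub> \<one>\<^bsub>R\<^esub> \<in> Units R \<longrightarrow>
           Im_I_minus = a_kernel A A (\<lambda>a. a \<oplus>\<^bsub>A\<^esub> \<phi> a) \<and>
           radical A Im_I_minus = nilpotents A \<and>
           mathieu_subspace R A Im_I_minus)"
proof -
  interpret assoc_algebra_endo R A \<phi>
    using assms(1,2) by (simp add: assoc_algebra_endo_def assoc_algebra_endo_axioms_def)
  show ?thesis
    \<comment> \<open>In each case the image is first rewritten as a kernel; the radical and Mathieu
      claims are then the ones proved for that kernel.\<close>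
    unfolding Im_I_minus_def
    using image_minus_idempotent mathieu_kernel_endo image_minus_involution radical_kernel_plus
      mathieu_kernel_plus
    by simp
qed

end
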